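(* The category $\mathbf{SupOMLatLin}$ is a dagger kernel category. The dagger kernel of a morphism $f\colon X\to Y$ is the inclusion $k\colon\downarrow k\to X$, where $k=f^{*}(1)^{\perp}\in X$ and $\downarrow k=\{x\in X\colon x\le k\}$.
   Context: An orthomodular lattice is a lattice with $0,1$ and an involutive, order-reversing orthocomplement $x\mapsto x^\perp$ with $x\wedge x^\perp=0$, satisfying $x\le y\Rightarrow y=x\vee(x^\perp\wedge y)$; complete means all joins exist. $x\perp y$ means $x\le y^\perp$. $\mathbf{SupOMLatLin}$ has complete orthomodular lattices as objects and linear maps as morphisms: $f\colon X\to Y$ is linear if there is $f^{*}\colon Y\to X$ (its unique adjoint) with $f(x)\perp y$ iff $x\perp f^{*}(y)$; composition is composition of functions, and the dagger is $f\mapsto f^{*}$. For $k\in X$, $\downarrow k$ is a complete orthomodular lattice with the order of $X$ and orthocomplement $u\mapsto k\wedge u^{\perp}$, and the inclusion $\downarrow k\to X$ is linear. The one-element lattice $\{0\}$ is a zero object; $0_{A,B}\colon A\to B$ denotes the constant-$0$ morphism. A dagger kernel category is a dagger category with a zero object in which every morphism $f\colon A\to B$ has a dagger kernel: a morphism $k\colon K\to A$ with $f\circ k=0_{K,B}$, $k^{*}\circ k=1_K$, and such that whenever $m\colon M\to A$ satisfies $f\circ m=0_{M,B}$ then $k\circ k^{*}\circ m=m$. *)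

theory Defs
  imports "HOL-Algebra.Complete_Lattice" "HOL-Library.FuncSet"
begin

section \<open>Dagger kernel categories\<close>

text \<open>
  Hom-sets are indexed by pairs of objects and need not be disjoint, so composition
  and dagger take the objects involved as arguments:
  \<open>Cmp C A B D g f\<close> is the composite of \<open>f : A \<rightarrow> B\<close> and \<open>g : B \<rightarrow> D\<close>,
  and \<open>Dag C A B f : B \<rightarrow> A\<close> is the dagger of \<open>f : A \<rightarrow> B\<close>.
\<close>

record ('o, 'm) dagger_structure =
  Obj :: "'o set"
  Hom :: "'o \<Rightarrow> 'o \<Rightarrow> 'm set"
  Idt :: "'o \<Rightarrow> 'm"
  Cmp :: "'o \<Rightarrow> 'o \<Rightarrow> 'o \<Rightarrow> 'm \<Rightarrow> 'm \<Rightarrow> 'm"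
  Dag :: "'o \<Rightarrow> 'o \<Rightarrow> 'm \<Rightarrow> 'm"

locale dagger_category =
  fixes C :: "('o, 'm) dagger_structure"
  assumes Idt_in_Hom: "A \<in> Obj C \<Longrightarrow> Idt C A \<in> Hom C A A"
    and Cmp_in_Hom:
      "\<lbrakk>A \<in> Obj C; B \<in> Obj C; D \<in> Obj C; f \<in> Hom C A B; g \<in> Hom C B D\<rbrakk>
        \<Longrightarrow> Cmp C A B D g f \<in> Hom C A D"
    and Cmp_Idt_right:
      "\<lbrakk>A \<in> Obj C; B \<in> Obj C; f \<in> Hom C A B\<rbrakk> \<Longrightarrow> Cmp C A A B f (Idt C A) = f"
    and Cmp_Idt_left:
      "\<lbrakk>A \<in> Obj C; B \<in> Obj C; f \<in> Hom C A B\<rbrakk> \<Longrightarrow> Cmp C A B B (Idt C B) f = f"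
    and Cmp_assoc:
      "\<lbrakk>A \<in> Obj C; B \<in> Obj C; D \<in> Obj C; E \<in> Obj C;
        f \<in> Hom C A B; g \<in> Hom C B D; h \<in> Hom C D E\<rbrakk>
        \<Longrightarrow> Cmp C A D E h (Cmp C A B D g f) = Cmp C A B E (Cmp C B D E h g) f"
    and Dag_in_Hom:
      "\<lbrakk>A \<in> Obj C; B \<in> Obj C; f \<in> Hom C A B\<rbrakk> \<Longrightarrow> Dag C A B f \<in> Hom C B A"
    and Dag_Idt: "A \<in> Obj C \<Longrightarrow> Dag C A A (Idt C A) = Idt C A"
    and Dag_Cmp:
      "\<lbrakk>A \<in> Obj C; B \<in> Obj C; D \<in> Obj C; f \<in> Hom C A B; g \<in> Hom C B D\<rbrakk>
        \<Longrightarrow> Dag C A D (Cmp C A B D g f) = Cmp C D B A (Dag C A B f) (Dag C B D g)"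
    and Dag_Dag:
      "\<lbrakk>A \<in> Obj C; B \<in> Obj C; f \<in> Hom C A B\<rbrakk> \<Longrightarrow> Dag C B A (Dag C A B f) = f"

definition zero_object :: "('o, 'm) dagger_structure \<Rightarrow> 'o \<Rightarrow> bool" where
  "zero_object C Z \<longleftrightarrow> Z \<in> Obj C \<and>
     (\<forall>A\<in>Obj C. (\<exists>!f. f \<in> Hom C Z A) \<and> (\<exists>!f. f \<in> Hom C A Z))"

text \<open>
  The zero morphism is the composite \<open>A \<rightarrow> Z \<rightarrow> B\<close> through a zero object.
  For complete orthomodular lattices it is the constant-\<open>0\<close> map;
  see the lemma \<open>zero_mor_SupOMLatLin\<close> below.
\<close>

definition zero_mor :: "('o, 'm) dagger_structure \<Rightarrow> 'o \<Rightarrow> 'o \<Rightarrow> 'm" where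
  "zero_mor C A B = (THE h. \<exists>Z u v. zero_object C Z \<and> u \<in> Hom C A Z \<and> v \<in> Hom C Z B \<and>
     h = Cmp C A Z B v u)"

definition is_dagger_kernel ::
  "('o, 'm) dagger_structure \<Rightarrow> 'o \<Rightarrow> 'o \<Rightarrow> 'm \<Rightarrow> 'o \<Rightarrow> 'm \<Rightarrow> bool" where
  "is_dagger_kernel C A B f K k \<longleftrightarrow>
     K \<in> Obj C \<and> k \<in> Hom C K A \<and>
     Cmp C K A B f k = zero_mor C K B \<and>
     Cmp C K A K (Dag C K A k) k = Idt C K \<and>
     (\<forall>M\<in>Obj C. \<forall>m\<in>Hom C M A. Cmp C M A B f m = zero_mor C M B \<longrightarrow>
        Cmp C M K A k (Cmp C M A K (Dag C K A k) m) = m)"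

locale dagger_kernel_category = dagger_category C
  for C :: "('o, 'm) dagger_structure" +
  assumes ex_zero_object: "\<exists>Z. zero_object C Z"
    and ex_dagger_kernel:
      "\<lbrakk>A \<in> Obj C; B \<in> Obj C; f \<in> Hom C A B\<rbrakk> \<Longrightarrow> \<exists>K k. is_dagger_kernel C A B f K k"


section \<open>Complete orthomodular lattices\<close>

record 'a ortho_order = "'a gorder" +
  ocompl :: "'a \<Rightarrow> 'a" (\<open>orth\<index>\<close>)

text \<open>
  The locale \<open>complete_lattice\<close> makes the \<open>eq\<close> component genuine equality.
  The values of \<open>le\<close> and \<open>ocompl\<close> outside the carrier are irrelevant.
\<close>

locale complete_orthomodular_lattice = complete_lattice X
  for X :: "'a ortho_order" (structure) +
  assumes orth_closed: "x \<in> carrier X \<Longrightarrow> orth x \<in> carrier X"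
    and orth_orth: "x \<in> carrier X \<Longrightarrow> orth (orth x) = x"
    and orth_antimono:
      "\<lbrakk>x \<in> carrier X; y \<in> carrier X; x \<sqsubseteq> y\<rbrakk> \<Longrightarrow> orth y \<sqsubseteq> orth x"
    and meet_orth: "x \<in> carrier X \<Longrightarrow> x \<sqinter> orth x = \<bottom>"
    and orthomodular:
      "\<lbrakk>x \<in> carrier X; y \<in> carrier X; x \<sqsubseteq> y\<rbrakk> \<Longrightarrow> y = x \<squnion> (orth x \<sqinter> y)"

definition perp :: "'a ortho_order \<Rightarrow> 'a \<Rightarrow> 'a \<Rightarrow> bool" where
  "perp X x y \<longleftrightarrow> x \<sqsubseteq>\<^bsub>X\<^esub> orth\<^bsub>X\<^esub> y"

definition downset :: "'a ortho_order \<Rightarrow> 'a \<Rightarrow> 'a ortho_order" where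
  "downset X k =
     X\<lparr>carrier := {x \<in> carrier X. x \<sqsubseteq>\<^bsub>X\<^esub> k}, ocompl := (\<lambda>u. k \<sqinter>\<^bsub>X\<^esub> orth\<^bsub>X\<^esub> u)\<rparr>"

definition inclusion :: "'a ortho_order \<Rightarrow> 'a ortho_order \<Rightarrow> 'a \<Rightarrow> 'a" where
  "inclusion K X = (\<lambda>x\<in>carrier K. x)"


section \<open>Linear maps and their category\<close>

text \<open>
  Maps are taken extensional (value \<open>undefined\<close> outside the carrier), so that equality
  of HOL functions is equality of maps between the carriers.
\<close>

definition is_adjoint ::
  "'a ortho_order \<Rightarrow> 'b ortho_order \<Rightarrow> ('a \<Rightarrow> 'b) \<Rightarrow> ('b \<Rightarrow> 'a) \<Rightarrow> bool" where
  "is_adjoint X Y f g \<longleftrightarrow> g \<in> carrier Y \<rightarrow>\<^sub>E carrier X \<and>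
     (\<forall>x\<in>carrier X. \<forall>y\<in>carrier Y. perp Y (f x) y \<longleftrightarrow> perp X x (g y))"

definition linear_maps :: "'a ortho_order \<Rightarrow> 'b ortho_order \<Rightarrow> ('a \<Rightarrow> 'b) set" where
  "linear_maps X Y = {f \<in> carrier X \<rightarrow>\<^sub>E carrier Y. \<exists>g. is_adjoint X Y f g}"

definition adj :: "'a ortho_order \<Rightarrow> 'b ortho_order \<Rightarrow> ('a \<Rightarrow> 'b) \<Rightarrow> 'b \<Rightarrow> 'a" where
  "adj X Y f = (THE g. is_adjoint X Y f g)"

text \<open>
  The objects are the complete orthomodular lattices whose carrier is a subset of the
  type \<open>'a\<close>, which plays the role of the universe.
\<close>

definition SupOMLatLin :: "('a ortho_order, 'a \<Rightarrow> 'a) dagger_structure" where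
  "SupOMLatLin =
     \<lparr>Obj = {X. complete_orthomodular_lattice X},
      Hom = linear_maps,
      Idt = (\<lambda>X. \<lambda>x\<in>carrier X. x),
      Cmp = (\<lambda>X Y Z g f. compose (carrier X) g f),
      Dag = adj\<rparr>"


section \<open>Adjoints and zero morphisms\<close>

lemma SupOMLatLin_simps [simp]:
  "X \<in> Obj SupOMLatLin \<longleftrightarrow> complete_orthomodular_lattice X"
  "Hom SupOMLatLin = linear_maps"
  "Idt SupOMLatLin X = (\<lambda>x\<in>carrier X. x)"
  "Cmp SupOMLatLin X Y Z g f = compose (carrier X) g f"
  "Dag SupOMLatLin = adj"
  by (simp_all add: SupOMLatLin_def)

context complete_orthomodular_lattice
begin

lemma le_orth_swap:
  assumes "x \<in> carrier X" "y \<in> carrier X" "x \<sqsubseteq> orth y"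
  shows "y \<sqsubseteq> orth x"
  using orth_antimono[OF assms(1) orth_closed[OF assms(2)] assms(3)] orth_orth[OF assms(2)]
  by simp

lemma perp_bottom_left: "y \<in> carrier X \<Longrightarrow> perp X \<bottom> y"
  by (simp add: perp_def orth_closed)

lemma perp_bottom_right: "x \<in> carrier X \<Longrightarrow> perp X x \<bottom>"
  unfolding perp_def by (rule le_orth_swap) (simp_all add: orth_closed)

lemma perp_self: "\<lbrakk>x \<in> carrier X; perp X x x\<rbrakk> \<Longrightarrow> x = \<bottom>"
  unfolding perp_def
  by (metis bottom_closed bottom_lower le_antisym le_refl meet_le meet_orth orth_closed)

end

lemma is_adjoint_unique:
  assumes X: "complete_orthomodular_lattice X" and g: "is_adjoint X Y f g" and h: "is_adjoint X Y f h"
  shows "g = h"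
proof (rule PiE_ext)
  interpret X: complete_orthomodular_lattice X by (rule X)
  show g': "g \<in> carrier Y \<rightarrow>\<^sub>E carrier X" and h': "h \<in> carrier Y \<rightarrow>\<^sub>E carrier X"
    using g h by (auto simp: is_adjoint_def)
  fix y assume y: "y \<in> carrier Y"
  have gy: "g y \<in> carrier X" and hy: "h y \<in> carrier X" using g' h' y by auto
  have *: "x \<sqsubseteq>\<^bsub>X\<^esub> orth\<^bsub>X\<^esub> (g y) \<longleftrightarrow> x \<sqsubseteq>\<^bsub>X\<^esub> orth\<^bsub>X\<^esub> (h y)" if "x \<in> carrier X" for x
    using g h y that by (auto simp: is_adjoint_def perp_def)
  have "orth\<^bsub>X\<^esub> (g y) = orth\<^bsub>X\<^esub> (h y)"
    using *[OF X.orth_closed[OF gy]] *[OF X.orth_closed[OF hy]] X.orth_closed[OF gy] X.orth_closed[OF hy]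
    by (auto intro: X.le_antisym)
  then show "g y = h y" by (metis X.orth_orth gy hy)
qed

lemma is_adjoint_adj:
  assumes "complete_orthomodular_lattice X" and "f \<in> linear_maps X Y"
  shows "is_adjoint X Y f (adj X Y f)"
proof -
  have "\<exists>!g. is_adjoint X Y f g"
    using assms is_adjoint_unique unfolding linear_maps_def by blast
  then show ?thesis unfolding adj_def by (rule theI')
qed

lemma const_bottom_linear:
  assumes "complete_orthomodular_lattice X" "complete_orthomodular_lattice Y"
  shows "(\<lambda>x\<in>carrier X. \<bottom>\<^bsub>Y\<^esub>) \<in> linear_maps X Y"
proof -
  interpret X: complete_orthomodular_lattice X by fact
  interpret Y: complete_orthomodular_lattice Y by fact
  have "is_adjoint X Y (\<lambda>x\<in>carrier X. \<bottom>\<^bsub>Y\<^esub>) (\<lambda>y\<in>carrier Y. \<bottom>\<^bsub>X\<^esub>)"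
    by (auto simp: is_adjoint_def Y.perp_bottom_left X.perp_bottom_right)
  then show ?thesis unfolding linear_maps_def by auto
qed

lemma linear_bottom:
  assumes "complete_orthomodular_lattice X" "complete_orthomodular_lattice Y" "f \<in> linear_maps X Y"
  shows "f \<bottom>\<^bsub>X\<^esub> = \<bottom>\<^bsub>Y\<^esub>"
proof -
  interpret X: complete_orthomodular_lattice X by fact
  interpret Y: complete_orthomodular_lattice Y by fact
  obtain g where g: "is_adjoint X Y f g" and f: "f \<in> carrier X \<rightarrow> carrier Y"
    using assms(3) by (auto simp: linear_maps_def)
  have fb: "f \<bottom>\<^bsub>X\<^esub> \<in> carrier Y" using f by auto
  have "g (f \<bottom>\<^bsub>X\<^esub>) \<in> carrier X" using g fb by (auto simp: is_adjoint_def)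
  then have "perp Y (f \<bottom>\<^bsub>X\<^esub>) (f \<bottom>\<^bsub>X\<^esub>)"
    using g fb X.perp_bottom_left by (auto simp: is_adjoint_def)
  then show ?thesis using Y.perp_self fb by blast
qed

lemma zero_object_carrier:
  assumes "zero_object SupOMLatLin Z"
  shows "carrier Z = {\<bottom>\<^bsub>Z\<^esub>}"
proof -
  have Z: "complete_orthomodular_lattice Z" using assms by (simp add: zero_object_def)
  interpret Z: complete_orthomodular_lattice Z by fact
  have "is_adjoint Z Z (\<lambda>x\<in>carrier Z. x) (\<lambda>x\<in>carrier Z. x)"
    by (auto simp: is_adjoint_def)
  then have "(\<lambda>x\<in>carrier Z. x) \<in> linear_maps Z Z"
    unfolding linear_maps_def by auto
  moreover have "(\<lambda>x\<in>carrier Z. \<bottom>\<^bsub>Z\<^esub>) \<in> linear_maps Z Z"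
    using Z Z by (rule const_bottom_linear)
  moreover have "\<exists>!f. f \<in> linear_maps Z Z" using assms Z by (simp add: zero_object_def)
  ultimately have eq: "(\<lambda>x\<in>carrier Z. x) = (\<lambda>x\<in>carrier Z. \<bottom>\<^bsub>Z\<^esub>)" by blast
  have "x = \<bottom>\<^bsub>Z\<^esub>" if "x \<in> carrier Z" for x
    using fun_cong[OF eq, of x] that by simp
  then show ?thesis by auto
qed

lemma zero_object_singleton:
  fixes a :: 'a
  defines "Z \<equiv> \<lparr>carrier = {a}, eq = (=), le = (=), ocompl = (\<lambda>x. x)\<rparr>"
  shows "zero_object SupOMLatLin Z"
proof -
  have po: "partial_order Z"
    by unfold_locales (auto simp: Z_def)
  interpret P: partial_order Z by (rule po)
  have cl: "complete_lattice Z"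
  proof
    fix A assume "A \<subseteq> carrier Z"
    show "\<exists>s. least Z s (Upper Z A)"
      by (rule exI[of _ a]) (use \<open>A \<subseteq> carrier Z\<close> in \<open>auto simp: least_def Upper_def Z_def\<close>)
    show "\<exists>i. greatest Z i (Lower Z A)"
      by (rule exI[of _ a]) (use \<open>A \<subseteq> carrier Z\<close> in \<open>auto simp: greatest_def Lower_def Z_def\<close>)
  qed
  interpret L: complete_lattice Z by (rule cl)
  have carr: "x = a \<longleftrightarrow> x \<in> carrier Z" for x by (simp add: Z_def)
  have uniq: "x = y" if "x \<in> carrier Z" "y \<in> carrier Z" for x y using that carr by metis
  have orth: "orth\<^bsub>Z\<^esub> x = x" for x by (simp add: Z_def)
  have Z: "complete_orthomodular_lattice Z"
  proof
    fix x y assume x: "x \<in> carrier Z"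
    show "x \<sqinter>\<^bsub>Z\<^esub> orth\<^bsub>Z\<^esub> x = \<bottom>\<^bsub>Z\<^esub>"
      unfolding orth by (rule uniq[OF L.meet_closed[OF x x] L.bottom_closed])
    assume y: "y \<in> carrier Z"
    show "y = x \<squnion>\<^bsub>Z\<^esub> (orth\<^bsub>Z\<^esub> x \<sqinter>\<^bsub>Z\<^esub> y)"
      unfolding orth by (rule uniq[OF y L.join_closed[OF x L.meet_closed[OF x y]]])
  qed (simp_all add: Z_def)
  have "(\<exists>!f. f \<in> linear_maps Z A) \<and> (\<exists>!f. f \<in> linear_maps A Z)"
    if A: "complete_orthomodular_lattice A" for A :: "'a ortho_order"
  proof
    have "f = (\<lambda>x\<in>carrier Z. \<bottom>\<^bsub>A\<^esub>)" if "f \<in> linear_maps Z A" for f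
    proof (rule extensionalityI[of _ "carrier Z"])
      show "f x = (\<lambda>x\<in>carrier Z. \<bottom>\<^bsub>A\<^esub>) x" if "x \<in> carrier Z" for x
        using that linear_bottom[OF Z A \<open>f \<in> linear_maps Z A\<close>] uniq[OF that L.bottom_closed] by simp
    qed (use that in \<open>auto simp: linear_maps_def PiE_def\<close>)
    then show "\<exists>!f. f \<in> linear_maps Z A" using const_bottom_linear[OF Z A] by blast
    have "f = (\<lambda>x\<in>carrier A. \<bottom>\<^bsub>Z\<^esub>)" if "f \<in> linear_maps A Z" for f
    proof (rule extensionalityI[of _ "carrier A"])
      show "f x = (\<lambda>x\<in>carrier A. \<bottom>\<^bsub>Z\<^esub>) x" if "x \<in> carrier A" for x
        using uniq[OF _ L.bottom_closed, of "f x"] that \<open>f \<in> linear_maps A Z\<close>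
        by (auto simp: linear_maps_def)
    qed (use that in \<open>auto simp: linear_maps_def PiE_def\<close>)
    then show "\<exists>!f. f \<in> linear_maps A Z" using const_bottom_linear[OF A Z] by blast
  qed
  then show ?thesis using Z by (simp add: zero_object_def)
qed

lemma zero_mor_SupOMLatLin:
  fixes A B :: "'a ortho_order"
  assumes A: "complete_orthomodular_lattice A" and B: "complete_orthomodular_lattice B"
  shows "zero_mor SupOMLatLin A B = (\<lambda>x\<in>carrier A. \<bottom>\<^bsub>B\<^esub>)"
  unfolding zero_mor_def SupOMLatLin_simps
proof (rule the_equality)
  have factor: "compose (carrier A) v u = (\<lambda>x\<in>carrier A. \<bottom>\<^bsub>B\<^esub>)"
    if zo: "zero_object SupOMLatLin Z" and u: "u \<in> linear_maps A Z" and v: "v \<in> linear_maps Z B"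
    for Z :: "'a ortho_order" and u v
  proof -
    have Z: "complete_orthomodular_lattice Z" using zo by (simp add: zero_object_def)
    have "v (u x) = \<bottom>\<^bsub>B\<^esub>" if "x \<in> carrier A" for x
    proof -
      have "u x \<in> carrier Z" using u that by (auto simp: linear_maps_def)
      then have "u x = \<bottom>\<^bsub>Z\<^esub>" using zero_object_carrier[OF zo] by blast
      then show ?thesis using linear_bottom[OF Z B v] by simp
    qed
    then show ?thesis by (auto simp: compose_def)
  qed
  obtain Z :: "'a ortho_order" where zo: "zero_object SupOMLatLin Z"
    using zero_object_singleton by (rule that)
  then have Z: "complete_orthomodular_lattice Z" by (simp add: zero_object_def)
  show "\<exists>(Z :: 'a ortho_order) u v. zero_object SupOMLatLin Z \<and> u \<in> linear_maps A Z \<and> v \<in> linear_maps Z B \<and>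
      (\<lambda>x\<in>carrier A. \<bottom>\<^bsub>B\<^esub>) = compose (carrier A) v u"
  proof (intro exI conjI)
    show "zero_object SupOMLatLin Z" by (fact zo)
    show "(\<lambda>x\<in>carrier A. \<bottom>\<^bsub>Z\<^esub>) \<in> linear_maps A Z" using A Z by (rule const_bottom_linear)
    show "(\<lambda>x\<in>carrier Z. \<bottom>\<^bsub>B\<^esub>) \<in> linear_maps Z B" using Z B by (rule const_bottom_linear)
    then show "(\<lambda>x\<in>carrier A. \<bottom>\<^bsub>B\<^esub>) =
        compose (carrier A) (\<lambda>x\<in>carrier Z. \<bottom>\<^bsub>B\<^esub>) (\<lambda>x\<in>carrier A. \<bottom>\<^bsub>Z\<^esub>)"
      using factor[OF zo const_bottom_linear[OF A Z]] by metis
  qed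
  fix h
  assume "\<exists>(Z :: 'a ortho_order) u v. zero_object SupOMLatLin Z \<and> u \<in> linear_maps A Z \<and>
      v \<in> linear_maps Z B \<and> h = compose (carrier A) v u"
  then obtain Z u v where "zero_object SupOMLatLin (Z :: 'a ortho_order)" "u \<in> linear_maps A Z"
      "v \<in> linear_maps Z B" and h: "h = compose (carrier A) v u"
    by (elim exE conjE) (rule that)
  then show "h = (\<lambda>x\<in>carrier A. \<bottom>\<^bsub>B\<^esub>)" unfolding h by (intro factor)
qed

end

theory Submission
  imports Defs
begin

text \<open>
  Adjointness gives \<open>f x = 0 \<longleftrightarrow> f x \<perp> 1 \<longleftrightarrow> x \<perp> f\<^sup>* 1 \<longleftrightarrow> x \<le> k\<close>, so a map is annihilated by \<open>f\<close>
  iff its image lies below \<open>k\<close>. The adjoint of the inclusion of the down-set of \<open>k\<close> sends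
  \<open>y\<close> to the complement of \<open>k \<and> y\<^sup>\<perp>\<close> relative to \<open>k\<close>; orthomodularity says that it fixes
  every \<open>y \<le> k\<close>, which yields both kernel equations.
\<close>

section \<open>Orthocomplement and order\<close>

context complete_orthomodular_lattice
begin

lemma perp_sym: "\<lbrakk>x \<in> carrier X; y \<in> carrier X\<rbrakk> \<Longrightarrow> perp X x y \<longleftrightarrow> perp X y x"
  unfolding perp_def using le_orth_swap by blast

text \<open>By symmetry \<open>\<top> \<sqsubseteq> orth x\<close>, so
  \<open>x \<sqsubseteq> orth x\<close>, and only \<open>\<bottom>\<close> is orthogonal to
  itself.\<close>

lemma perp_top_right:
  assumes "x \<in> carrier X" "perp X x \<top>"
  shows "x = \<bottom>"
proof (rule perp_self)
  have "perp X \<top> x" using assms perp_sym by simp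
  then show "perp X x x"
    unfolding perp_def using assms(1) by (meson le_trans orth_closed top_closed top_higher)
qed (fact assms)

text \<open>One inequality is antitonicity. The other is moved across the complement by
  \<open>le_orth_swap\<close>, which turns it into the universal property of the join.\<close>

lemma orth_join:
  assumes x: "x \<in> carrier X" and y: "y \<in> carrier X"
  shows "orth (x \<squnion> y) = orth x \<sqinter> orth y"
proof (rule le_antisym)
  note c = x y orth_closed[OF x] orth_closed[OF y]
  show "orth (x \<squnion> y) \<sqsubseteq> orth x \<sqinter> orth y"
    by (rule meet_le) (simp_all add: c orth_closed orth_antimono join_left join_right)
  have "x \<squnion> y \<sqsubseteq> orth (orth x \<sqinter> orth y)"
    by (rule join_le) (simp_all add: c orth_closed le_orth_swap meet_left meet_right)
  then show "orth x \<sqinter> orth y \<sqsubseteq> orth (x \<squnion> y)"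
    by (simp add: c le_orth_swap)
qed (simp_all add: x y orth_closed)

text \<open>Orthomodularity for \<open>orth k \<sqsubseteq> orth u\<close> splits
  \<open>orth u\<close> into \<open>orth k\<close> and \<open>k \<sqinter> orth u\<close>; De Morgan
  then gives the claim. It serves both as involutivity of the relative complement and as the fact
  that the projection onto \<open>k\<close> fixes everything below \<open>k\<close>.\<close>

lemma relative_orth_orth:
  assumes k: "k \<in> carrier X" and u: "u \<in> carrier X" and le: "u \<sqsubseteq> k"
  shows "k \<sqinter> orth (k \<sqinter> orth u) = u"
proof -
  have c: "k \<sqinter> orth u \<in> carrier X" "orth k \<in> carrier X" "orth u \<in> carrier X"
    using k u by (simp_all add: orth_closed)
  have "orth u = orth k \<squnion> (k \<sqinter> orth u)"
    using orthomodular[OF c(2,3) orth_antimono[OF u k le]] k by (simp add: orth_orth)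
  then have "orth (orth u) = orth (orth k) \<sqinter> orth (k \<sqinter> orth u)"
    using orth_join[OF c(2,1)] by simp
  then show ?thesis using k u by (simp add: orth_orth)
qed

end

section \<open>Down-sets\<close>

lemma downset_simps [simp]:
  "carrier (downset X k) = {x \<in> carrier X. x \<sqsubseteq>\<^bsub>X\<^esub> k}"
  "x \<sqsubseteq>\<^bsub>downset X k\<^esub> y \<longleftrightarrow> x \<sqsubseteq>\<^bsub>X\<^esub> y"
  "x .=\<^bsub>downset X k\<^esub> y \<longleftrightarrow> x .=\<^bsub>X\<^esub> y"
  "orth\<^bsub>downset X k\<^esub> x = k \<sqinter>\<^bsub>X\<^esub> orth\<^bsub>X\<^esub> x"
  by (simp_all add: downset_def)

context complete_orthomodular_lattice
begin

lemma complete_lattice_downset: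
  assumes k: "k \<in> carrier X"
  shows "complete_lattice (downset X k)"
proof -
  interpret D: partial_order "downset X k"
    by unfold_locales (auto simp: eq_is_equal fun_eq_iff intro: le_antisym le_trans)
  show ?thesis
  proof
    fix A assume "A \<subseteq> carrier (downset X k)"
    then have A: "A \<subseteq> carrier X" and Ak: "\<And>x. x \<in> A \<Longrightarrow> x \<sqsubseteq> k" by auto
    have "\<Squnion>A \<sqsubseteq> k" by (rule sup_least) (auto simp: A Ak k Upper_def)
    then have "least (downset X k) (\<Squnion>A) (Upper (downset X k) A)"
      using A Ak
      by (auto simp: least_def Upper_def intro!: sup_upper sup_least)
    then show "\<exists>s. least (downset X k) s (Upper (downset X k) A)" by blast
    \<comment> \<open>Cutting with \<open>k\<close> matters for empty \<open>A\<close>, whose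
      infimum in \<open>X\<close> is \<open>\<top>\<close> and may fail to lie below
      \<open>k\<close>. Suprema need no such correction.\<close>
    have lower: "k \<sqinter> \<Sqinter>A \<sqsubseteq> x" if "x \<in> A" for x
      using that A k meet_right[OF k inf_closed[OF A]] inf_lower[OF A that]
      by (meson inf_closed le_trans meet_closed subsetD)
    have "greatest (downset X k) (k \<sqinter> \<Sqinter>A) (Lower (downset X k) A)"
      using A Ak k lower
      by (auto simp: greatest_def Lower_def meet_left intro!: meet_le inf_greatest)
    then show "\<exists>i. greatest (downset X k) i (Lower (downset X k) A)" by blast
  qed
qed

lemma complete_orthomodular_lattice_downset:
  assumes k: "k \<in> carrier X"
  shows "complete_orthomodular_lattice (downset X k)"
proof -
  interpret D: complete_lattice "downset X k" using k by (rule complete_lattice_downset)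
  \<comment> \<open>The operations of \<open>downset X k\<close> are bounds relative to its own
    carrier, so their agreement with those of \<open>X\<close> is derived from the order. Afterwards
    each law can be checked in \<open>X\<close>.\<close>
  have bot: "\<bottom>\<^bsub>downset X k\<^esub> = \<bottom>"
    using D.bottom_closed D.bottom_lower[of \<bottom>] k by (auto intro: le_antisym)
  have meet: "x \<sqinter>\<^bsub>downset X k\<^esub> y = x \<sqinter> y"
    if x: "x \<in> carrier (downset X k)" and y: "y \<in> carrier (downset X k)" for x y
  proof (rule le_antisym)
    have c: "x \<in> carrier X" "y \<in> carrier X" "x \<sqsubseteq> k" using x y by auto
    have m: "x \<sqinter> y \<in> carrier (downset X k)"
      using c k le_trans[OF meet_left[OF c(1,2)] c(3)] by simp
    show "x \<sqinter>\<^bsub>downset X k\<^esub> y \<sqsubseteq> x \<sqinter> y"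
      using D.meet_left[OF x y] D.meet_right[OF x y] D.meet_closed[OF x y] c
      by (intro meet_le) auto
    show "x \<sqinter> y \<sqsubseteq> x \<sqinter>\<^bsub>downset X k\<^esub> y"
      using D.meet_le[OF _ _ x y m] meet_left meet_right c by simp
  qed (use D.meet_closed[OF x y] x y in auto)
  have join: "x \<squnion>\<^bsub>downset X k\<^esub> y = x \<squnion> y"
    if x: "x \<in> carrier (downset X k)" and y: "y \<in> carrier (downset X k)" for x y
  proof (rule le_antisym)
    have c: "x \<in> carrier X" "y \<in> carrier X" "x \<sqsubseteq> k" "y \<sqsubseteq> k" using x y by auto
    have m: "x \<squnion> y \<in> carrier (downset X k)"
      using c k join_le[OF c(3,4,1,2) k] by simp
    show "x \<squnion> y \<sqsubseteq> x \<squnion>\<^bsub>downset X k\<^esub> y"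
      using D.join_left[OF x y] D.join_right[OF x y] D.join_closed[OF x y] c
      by (intro join_le) auto
    show "x \<squnion>\<^bsub>downset X k\<^esub> y \<sqsubseteq> x \<squnion> y"
      using D.join_le[OF _ _ x y m] join_left join_right c by simp
  qed (use D.join_closed[OF x y] x y in auto)
  have orth_closed': "k \<sqinter> orth x \<in> carrier (downset X k)" if "x \<in> carrier X" for x
    using that k by (simp add: meet_left orth_closed)
  show ?thesis
  proof
    fix x assume x: "x \<in> carrier (downset X k)"
    then have xX: "x \<in> carrier X" and xk: "x \<sqsubseteq> k" by auto
    note c = k xX orth_closed[OF xX]
    show "orth\<^bsub>downset X k\<^esub> x \<in> carrier (downset X k)"
      using orth_closed'[OF xX] by simp
    show "orth\<^bsub>downset X k\<^esub> (orth\<^bsub>downset X k\<^esub> x) = x"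
      using relative_orth_orth[OF k xX xk] by simp
    have "x \<sqinter> (k \<sqinter> orth x) \<sqsubseteq> x \<sqinter> orth x"
      using c by (meson le_trans meet_closed meet_le meet_left meet_right)
    then have "x \<sqinter> (k \<sqinter> orth x) = \<bottom>"
      using c meet_orth[OF xX] by (simp add: le_antisym)
    then show "x \<sqinter>\<^bsub>downset X k\<^esub> orth\<^bsub>downset X k\<^esub> x = \<bottom>\<^bsub>downset X k\<^esub>"
      using meet[OF x orth_closed'[OF xX]] bot by simp
    fix y assume y: "y \<in> carrier (downset X k)" and "x \<sqsubseteq>\<^bsub>downset X k\<^esub> y"
    then have yX: "y \<in> carrier X" and yk: "y \<sqsubseteq> k" and xy: "x \<sqsubseteq> y" by auto
    note d = c yX orth_closed[OF yX]
    have "k \<sqinter> orth y \<sqsubseteq> k \<sqinter> orth x"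
      using d orth_antimono[OF xX yX xy]
      by (meson le_trans meet_closed meet_le meet_left meet_right)
    then show "orth\<^bsub>downset X k\<^esub> y \<sqsubseteq>\<^bsub>downset X k\<^esub> orth\<^bsub>downset X k\<^esub> x" by simp
    \<comment> \<open>Since \<open>y \<sqsubseteq> k\<close>, cutting with \<open>k\<close> changes
      nothing below \<open>y\<close>: the orthomodular law of \<open>X\<close> for
      \<open>x \<sqsubseteq> y\<close> is already the relative one.\<close>
    have "k \<sqinter> orth x \<sqinter> y = orth x \<sqinter> (k \<sqinter> y)"
      using d by (metis meet_assoc meet_comm)
    also have "k \<sqinter> y = y" using d yk by (simp add: le_antisym meet_le meet_right)
    finally have "k \<sqinter> orth x \<sqinter> y = orth x \<sqinter> y" .
    \<comment> \<open>The comparison of joins applies only to elements of the down-set.\<close>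
    moreover have "k \<sqinter> orth x \<sqinter> y \<in> carrier (downset X k)"
      using D.meet_closed[OF orth_closed'[OF xX] y] meet[OF orth_closed'[OF xX] y] by metis
    ultimately show "y = x \<squnion>\<^bsub>downset X k\<^esub> (orth\<^bsub>downset X k\<^esub> x \<sqinter>\<^bsub>downset X k\<^esub> y)"
      using orthomodular[OF xX yX xy] meet[OF orth_closed'[OF xX] y] join[OF x]
      by simp
  qed
qed

text \<open>The adjoint of the inclusion is the Sasaki projection onto \<open>k\<close>.\<close>

lemma is_adjoint_inclusion:
  assumes k: "k \<in> carrier X"
  shows "is_adjoint (downset X k) X (inclusion (downset X k) X)
    (\<lambda>y\<in>carrier X. k \<sqinter> orth (k \<sqinter> orth y))"
proof -
  have "x \<sqsubseteq> orth y \<longleftrightarrow> x \<sqsubseteq> k \<sqinter> orth (k \<sqinter> orth (k \<sqinter> orth y))"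
    if x: "x \<in> carrier X" "x \<sqsubseteq> k" and y: "y \<in> carrier X" for x y
  proof -
    have c: "orth y \<in> carrier X" "k \<sqinter> orth y \<in> carrier X"
      using k y by (simp_all add: orth_closed)
    \<comment> \<open>Three relative complements collapse to one, by
      \<open>relative_orth_orth\<close> at \<open>k \<sqinter> orth y\<close>. For
      \<open>x \<sqsubseteq> k\<close>, lying below \<open>k \<sqinter> orth y\<close> is the same
      as lying below \<open>orth y\<close>.\<close>
    have "k \<sqinter> orth (k \<sqinter> orth (k \<sqinter> orth y)) = k \<sqinter> orth y"
      using k c by (simp add: relative_orth_orth meet_left)
    then show ?thesis using k x c by (metis le_trans meet_le meet_right)
  qed
  then show ?thesis
    using k by (auto simp: is_adjoint_def inclusion_def perp_def orth_closed meet_left)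
qed

end

section \<open>The dagger category of complete orthomodular lattices\<close>

text \<open>Orthogonality is symmetric, so the adjointness equivalence can be read backwards; this
  makes daggers linear and the dagger involutive. \<open>is_adjoint\<close> restricts only its last
  map to the carriers, hence the separate assumption on \<open>f\<close>.\<close>

lemma is_adjoint_sym:
  assumes "complete_orthomodular_lattice X" "complete_orthomodular_lattice Y"
    and f: "f \<in> carrier X \<rightarrow>\<^sub>E carrier Y" and g: "is_adjoint X Y f g"
  shows "is_adjoint Y X g f"
proof -
  interpret X: complete_orthomodular_lattice X by fact
  interpret Y: complete_orthomodular_lattice Y by fact
  have "perp X (g y) x \<longleftrightarrow> perp Y y (f x)" if x: "x \<in> carrier X" and y: "y \<in> carrier Y" for x y
  proof -
    have "f x \<in> carrier Y" "g y \<in> carrier X" using f g x y by (auto simp: is_adjoint_def)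
    then show ?thesis
      using g x y X.perp_sym[of x "g y"] Y.perp_sym[of "f x" y] by (simp add: is_adjoint_def)
  qed
  then show ?thesis using f by (simp add: is_adjoint_def)
qed

lemma is_adjoint_compose:
  assumes f: "f \<in> carrier X \<rightarrow>\<^sub>E carrier Y"
    and f': "is_adjoint X Y f f'" and g': "is_adjoint Y Z g g'"
  shows "is_adjoint X Z (compose (carrier X) g f) (compose (carrier Z) f' g')"
proof -
  have "f x \<in> carrier Y" if "x \<in> carrier X" for x using f that by auto
  moreover have "g' z \<in> carrier Y" if "z \<in> carrier Z" for z
    using g' that by (auto simp: is_adjoint_def)
  ultimately show ?thesis
    using f' g' by (auto simp: is_adjoint_def compose_eq compose_def)
qed

lemma is_adjoint_id: "is_adjoint X X (\<lambda>x\<in>carrier X. x) (\<lambda>x\<in>carrier X. x)"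
  by (auto simp: is_adjoint_def)

text \<open>Uniqueness of adjoints resolves the definite description in \<open>adj\<close>. Daggers
  are computed below by exhibiting an adjoint.\<close>

lemma adj_eqI:
  assumes "complete_orthomodular_lattice X" "is_adjoint X Y f g"
  shows "adj X Y f = g"
  unfolding adj_def using assms is_adjoint_unique by blast

lemma linear_mapsD: "f \<in> linear_maps X Y \<Longrightarrow> f \<in> carrier X \<rightarrow>\<^sub>E carrier Y"
  by (simp add: linear_maps_def)

lemma linear_mapsI: "\<lbrakk>f \<in> carrier X \<rightarrow>\<^sub>E carrier Y; is_adjoint X Y f g\<rbrakk> \<Longrightarrow> f \<in> linear_maps X Y"
  by (auto simp: linear_maps_def)

lemma compose_PiE: "\<lbrakk>f \<in> A \<rightarrow>\<^sub>E B; g \<in> B \<rightarrow>\<^sub>E C\<rbrakk> \<Longrightarrow> compose A g f \<in> A \<rightarrow>\<^sub>E C"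
  by (auto simp: compose_def)

lemma is_adjoint_adj_sym:
  assumes "complete_orthomodular_lattice X" "complete_orthomodular_lattice Y" "f \<in> linear_maps X Y"
  shows "is_adjoint Y X (adj X Y f) f"
  using assms is_adjoint_adj is_adjoint_sym linear_mapsD by blast

lemma adj_PiE:
  assumes "complete_orthomodular_lattice X" "f \<in> linear_maps X Y"
  shows "adj X Y f \<in> carrier Y \<rightarrow>\<^sub>E carrier X"
  using is_adjoint_adj[OF assms] by (simp add: is_adjoint_def)

text \<open>The category laws are those of extensional functions; the dagger laws follow from
  explicit adjoints and their uniqueness.\<close>

lemma dagger_category_SupOMLatLin: "dagger_category SupOMLatLin"
proof (unfold_locales, unfold SupOMLatLin_simps)
  fix A :: "'a ortho_order"
  assume A: "complete_orthomodular_lattice A"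
  show "(\<lambda>x\<in>carrier A. x) \<in> linear_maps A A"
    using is_adjoint_id by (rule linear_mapsI[rotated]) auto
  show "adj A A (\<lambda>x\<in>carrier A. x) = (\<lambda>x\<in>carrier A. x)"
    using A is_adjoint_id by (rule adj_eqI)
next
  fix A B :: "'a ortho_order" and f
  assume A: "complete_orthomodular_lattice A" and B: "complete_orthomodular_lattice B"
    and f: "f \<in> linear_maps A B"
  note f' = linear_mapsD[OF f]
  show "compose (carrier A) f (\<lambda>x\<in>carrier A. x) = f"
    using f' compose_Id by (auto simp: PiE_def)
  show "compose (carrier A) (\<lambda>x\<in>carrier B. x) f = f"
    using f' Id_compose by (auto simp: PiE_def)
  show "adj A B f \<in> linear_maps B A"
    using adj_PiE[OF A f] is_adjoint_adj_sym[OF A B f] by (rule linear_mapsI)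
  show "adj B A (adj A B f) = f"
    using B is_adjoint_adj_sym[OF A B f] by (rule adj_eqI)
next
  fix A B D :: "'a ortho_order" and f g
  assume A: "complete_orthomodular_lattice A" and B: "complete_orthomodular_lattice B"
    and D: "complete_orthomodular_lattice D"
    and f: "f \<in> linear_maps A B" and g: "g \<in> linear_maps B D"
  have gf: "is_adjoint A D (compose (carrier A) g f) (compose (carrier D) (adj A B f) (adj B D g))"
    using linear_mapsD[OF f] is_adjoint_adj[OF A f] is_adjoint_adj[OF B g]
    by (rule is_adjoint_compose)
  show "compose (carrier A) g f \<in> linear_maps A D"
    using compose_PiE[OF linear_mapsD[OF f] linear_mapsD[OF g]] gf by (rule linear_mapsI)
  show "adj A D (compose (carrier A) g f) = compose (carrier D) (adj A B f) (adj B D g)"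
    using A gf by (rule adj_eqI)
next
  fix A B D E :: "'a ortho_order" and f g h
  assume "f \<in> linear_maps A B"
  then have "f \<in> carrier A \<rightarrow> carrier B" by (auto simp: linear_maps_def)
  then show "compose (carrier A) h (compose (carrier A) g f)
      = compose (carrier A) (compose (carrier B) h g) f"
    by (rule compose_assoc)
qed

section \<open>Dagger kernels as inclusions of down-sets\<close>

lemma is_dagger_kernel_downset:
  fixes X Y :: "'a ortho_order"
  assumes X: "complete_orthomodular_lattice X" and Y: "complete_orthomodular_lattice Y"
    and f: "f \<in> linear_maps X Y"
  defines "k \<equiv> orth\<^bsub>X\<^esub> (adj X Y f \<top>\<^bsub>Y\<^esub>)"
  shows "k \<in> carrier X"
    and "is_dagger_kernel SupOMLatLin X Y f (downset X k) (inclusion (downset X k) X)"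
proof -
  interpret X: complete_orthomodular_lattice X by (rule X)
  interpret Y: complete_orthomodular_lattice Y by (rule Y)
  let ?K = "downset X k" and ?i = "inclusion (downset X k) X"
  let ?p = "\<lambda>y\<in>carrier X. k \<sqinter>\<^bsub>X\<^esub> orth\<^bsub>X\<^esub> (k \<sqinter>\<^bsub>X\<^esub> orth\<^bsub>X\<^esub> y)"
  have fX: "f x \<in> carrier Y" if "x \<in> carrier X" for x
    using linear_mapsD[OF f] that by auto
  have "adj X Y f \<top>\<^bsub>Y\<^esub> \<in> carrier X" using adj_PiE[OF X f] Y.top_closed by auto
  then show k: "k \<in> carrier X" unfolding k_def by (rule X.orth_closed)
  have below_k: "x \<sqsubseteq>\<^bsub>X\<^esub> k \<longleftrightarrow> f x = \<bottom>\<^bsub>Y\<^esub>" if x: "x \<in> carrier X" for x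
  proof -
    have "x \<sqsubseteq>\<^bsub>X\<^esub> k \<longleftrightarrow> perp Y (f x) \<top>\<^bsub>Y\<^esub>"
      using is_adjoint_adj[OF X f] x by (simp add: is_adjoint_def perp_def k_def)
    also have "\<dots> \<longleftrightarrow> f x = \<bottom>\<^bsub>Y\<^esub>"
      using Y.perp_top_right[OF fX[OF x]] Y.perp_bottom_left[OF Y.top_closed] by auto
    finally show ?thesis .
  qed
  have K: "complete_orthomodular_lattice ?K"
    using k by (rule X.complete_orthomodular_lattice_downset)
  have p: "is_adjoint ?K X ?i ?p" using k by (rule X.is_adjoint_inclusion)
  then have adj_i: "adj ?K X ?i = ?p" using K by (intro adj_eqI)
  have p_id: "?p x = x" if "x \<in> carrier X" "x \<sqsubseteq>\<^bsub>X\<^esub> k" for x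
    using that X.relative_orth_orth[OF k that] by simp
  have "?i \<in> linear_maps ?K X"
    using p by (rule linear_mapsI[rotated]) (auto simp: inclusion_def)
  \<comment> \<open>Replacing the abstract zero morphism by the constant map makes the equation
    pointwise, where it is \<open>below_k\<close>.\<close>
  moreover have "compose (carrier ?K) f ?i = zero_mor SupOMLatLin ?K Y"
    unfolding zero_mor_SupOMLatLin[OF K Y]
    by (rule ext) (auto simp: compose_def restrict_def inclusion_def below_k)
  moreover have "compose (carrier ?K) ?p ?i = (\<lambda>x\<in>carrier ?K. x)"
    by (rule ext) (use p_id in \<open>simp add: compose_def restrict_def inclusion_def\<close>)
  \<comment> \<open>As \<open>f\<close> sends every value of \<open>m\<close> to
    \<open>\<bottom>\<close>, these values lie below \<open>k\<close>, where \<open>?p\<close> and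
    then \<open>?i\<close> act as the identity.\<close>
  moreover have "compose (carrier M) ?i (compose (carrier M) ?p m) = m"
    if M: "complete_orthomodular_lattice M" and m: "m \<in> linear_maps M X"
      and 0: "compose (carrier M) f m = zero_mor SupOMLatLin M Y" for M m
  proof (rule extensionalityI[of _ "carrier M"])
    show "m \<in> extensional (carrier M)" using linear_mapsD[OF m] by (simp add: PiE_def)
    fix z assume z: "z \<in> carrier M"
    have mz: "m z \<in> carrier X" using linear_mapsD[OF m] z by auto
    have "f (m z) = \<bottom>\<^bsub>Y\<^esub>"
      using fun_cong[OF 0, of z] z by (simp add: zero_mor_SupOMLatLin[OF M Y] compose_eq)
    then have mk: "m z \<sqsubseteq>\<^bsub>X\<^esub> k" using below_k[OF mz] by simp
    show "compose (carrier M) ?i (compose (carrier M) ?p m) z = m z"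
      unfolding compose_eq[OF z] p_id[OF mz mk] using mz mk by (simp add: inclusion_def)
  qed (rule compose_extensional)
  ultimately show "is_dagger_kernel SupOMLatLin X Y f ?K ?i"
    unfolding is_dagger_kernel_def SupOMLatLin_simps adj_i
    by (intro conjI ballI impI K) simp_all
qed

theorem theorem12:
  shows "dagger_kernel_category (SupOMLatLin :: ('a ortho_order, 'a \<Rightarrow> 'a) dagger_structure) \<and>
    (\<forall>X \<in> Obj (SupOMLatLin :: ('a ortho_order, 'a \<Rightarrow> 'a) dagger_structure).
     \<forall>Y \<in> Obj SupOMLatLin. \<forall>f \<in> Hom SupOMLatLin X Y.
       let k = orth\<^bsub>X\<^esub> (Dag SupOMLatLin X Y f \<top>\<^bsub>Y\<^esub>)
       in k \<in> carrier X \<and>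
          is_dagger_kernel SupOMLatLin X Y f (downset X k) (inclusion (downset X k) X))"
proof
  show "dagger_kernel_category (SupOMLatLin :: ('a ortho_order, 'a \<Rightarrow> 'a) dagger_structure)"
  proof (intro dagger_kernel_category.intro dagger_category_SupOMLatLin
      dagger_kernel_category_axioms.intro)
    \<comment> \<open>Types are inhabited, so a one-element lattice exists within the universe
      \<open>'a\<close>.\<close>
    show "\<exists>Z. zero_object (SupOMLatLin :: ('a ortho_order, 'a \<Rightarrow> 'a) dagger_structure) Z"
      using zero_object_singleton by (rule exI)
  qed (auto dest: is_dagger_kernel_downset(2))
qed (simp add: is_dagger_kernel_downset Let_def)

end
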